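(* Let $G = (V, E)$ be a graph and $\mathcal{M} = (E, \mathcal{I})$ be a matroid. Then there exists a normalized, non-negative, integer-valued, supermodular function $f:2^V\rightarrow\mathbb{Z}_{\geq 0}$ such that for every subset $F\subseteq V$ of vertices, we have $E[V - F] \in \mathcal{I}$ if and only if $\lambda^*_{f|_{V - F}}\leq 1$.
   Context: Here $E[V-F]$ is the set of edges of $G$ with both end vertices in $V\setminus F$, and $\mathcal{I}$ is the collection of independent sets of the matroid $\mathcal{M}$ on the edge set $E$. A set function $f:2^V\to\mathbb{R}$ is supermodular if $f(A)+f(B)\le f(A\cap B)+f(A\cup B)$ for all $A,B\subseteq V$, and normalized if $f(\emptyset)=0$. $f|_{V-F}$ is the restriction of $f$ to subsets of $V\setminus F$. The density of $f$ on ground set $V$ is $\lambda^*_f:=\max\{f(S)/|S|:\emptyset\neq S\subseteq V\}$; for an empty ground set the condition $\lambda^*_f\le1$ is considered to hold. *)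

theory Defs
  imports Complex_Main "HOL-Library.FuncSet"
begin

text \<open>Finite undirected graphs, with parallel edges and loops allowed: each edge is mapped to
  the set of its end vertices, a singleton for a loop.  A simple graph, whose edges are
  two-element vertex sets, is the instance in which \<open>ends\<close> is the identity.\<close>

locale ugraph =
  fixes V :: "'v set" and E :: "'e set" and ends :: "'e \<Rightarrow> 'v set"
  assumes finite_V: "finite V"
    and finite_E: "finite E"
    and ends_subset: "e \<in> E \<Longrightarrow> ends e \<subseteq> V"
    and card_ends: "e \<in> E \<Longrightarrow> card (ends e) \<in> {1, 2}"

definition induced_edges :: "'e set \<Rightarrow> ('e \<Rightarrow> 'v set) \<Rightarrow> 'v set \<Rightarrow> 'e set" where
  "induced_edges E ends U = {e \<in> E. ends e \<subseteq> U}"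

locale matroid =
  fixes E :: "'e set" and \<I> :: "'e set set"
  assumes finite_ground: "finite E"
    and indep_subset_ground: "X \<in> \<I> \<Longrightarrow> X \<subseteq> E"
    and indep_empty: "{} \<in> \<I>"
    and indep_subset: "X \<in> \<I> \<Longrightarrow> Y \<subseteq> X \<Longrightarrow> Y \<in> \<I>"
    and augment: "X \<in> \<I> \<Longrightarrow> Y \<in> \<I> \<Longrightarrow> card X < card Y \<Longrightarrow> \<exists>y \<in> Y - X. insert y X \<in> \<I>"

text \<open>A set function on the subsets of \<open>V\<close> is a total function of which only the values on
  \<open>Pow V\<close> matter; hence its ground set is an explicit argument below.\<close>

definition supermodular_on :: "'v set \<Rightarrow> ('v set \<Rightarrow> real) \<Rightarrow> bool" where
  "supermodular_on V f \<longleftrightarrow>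
     (\<forall>A B. A \<subseteq> V \<longrightarrow> B \<subseteq> V \<longrightarrow> f A + f B \<le> f (A \<inter> B) + f (A \<union> B))"

text \<open>Meaningful only for a finite nonempty ground set, as \<open>Max {}\<close> is unspecified.\<close>

definition max_density :: "'v set \<Rightarrow> ('v set \<Rightarrow> real) \<Rightarrow> real" where
  "max_density V f = Max {f S / real (card S) | S. S \<noteq> {} \<and> S \<subseteq> V}"

definition max_density_le_1 :: "'v set \<Rightarrow> ('v set \<Rightarrow> real) \<Rightarrow> bool" where
  "max_density_le_1 V f \<longleftrightarrow> V = {} \<or> max_density V f \<le> 1"

end

theory Submission imports Defs begin

text \<open>Only heredity of independence matters.  Put \<open>f S = 2 ^ card S\<close> if the edges induced by \<open>S\<close>
  are dependent, and \<open>f S = 0\<close> otherwise.  Since \<open>f\<close> is monotone and at least doubles whenever a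
  dependent set grows, \<open>f A + f B \<le> f (A \<union> B)\<close> for incomparable \<open>A\<close> and \<open>B\<close>, so \<open>f\<close> is
  supermodular.  Moreover \<open>2 ^ k > k\<close>, so every dependent set has density above 1.\<close>

lemma supermodular_on_upward_closed_pow2:
  fixes D :: "'v set \<Rightarrow> bool"
  assumes "finite V" and mono: "\<And>A B. A \<subseteq> B \<Longrightarrow> B \<subseteq> V \<Longrightarrow> D A \<Longrightarrow> D B"
  shows "supermodular_on V (\<lambda>S. if D S then 2 ^ card S else 0)"
    (is "supermodular_on V ?f")
  unfolding supermodular_on_def
proof (intro allI impI)
  fix A B assume AB: "A \<subseteq> V" "B \<subseteq> V"
  show "?f A + ?f B \<le> ?f (A \<inter> B) + ?f (A \<union> B)"
  proof (cases "A \<subseteq> B \<or> B \<subseteq> A")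
    case True
    then show ?thesis
      by (elim disjE) (simp_all add: Int_absorb1 Int_absorb2 Un_absorb1 Un_absorb2)
  next
    case False
    have half: "2 * ?f C \<le> ?f (A \<union> B)" if "C \<subset> A \<union> B" for C
    proof (cases "D C")
      case True
      have "D (A \<union> B)"
        using mono[of C "A \<union> B"] that True AB by blast
      moreover have "card C < card (A \<union> B)"
        using that AB \<open>finite V\<close> by (meson Un_least finite_subset psubset_card_mono)
      then have "(2::real) ^ Suc (card C) \<le> 2 ^ card (A \<union> B)"
        by (intro power_increasing) auto
      ultimately show ?thesis using True by simp
    qed simp
    \<comment> \<open>Incomparability makes \<open>A\<close> and \<open>B\<close> proper subsets of
      their union, so each value is at most half of the value there.\<close>
    have "2 * ?f A \<le> ?f (A \<union> B)" "2 * ?f B \<le> ?f (A \<union> B)"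
      using False by (intro half; blast)+
    moreover have "0 \<le> ?f (A \<inter> B)" by simp
    ultimately show ?thesis by linarith
  qed
qed

text \<open>Trades the maximum of quotients for one inequality per nonempty set; for empty
  \<open>U\<close> both sides hold trivially.\<close>

lemma max_density_le_1_iff:
  assumes "finite U"
  shows "max_density_le_1 U f \<longleftrightarrow> (\<forall>S \<subseteq> U. S \<noteq> {} \<longrightarrow> f S \<le> real (card S))"
proof (cases "U = {}")
  case True
  then show ?thesis by (simp add: max_density_le_1_def)
next
  case False
  let ?X = "{f S / real (card S) | S. S \<noteq> {} \<and> S \<subseteq> U}"
  \<comment> \<open>A maximum is bounded by its elements only over a finite nonempty set, so both
    properties are secured first.\<close>
  have "?X \<subseteq> (\<lambda>S. f S / real (card S)) ` Pow U" by blast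
  then have "finite ?X" by (rule finite_subset) (simp add: assms)
  moreover have "?X \<noteq> {}" using False by blast
  ultimately have "max_density U f \<le> 1 \<longleftrightarrow> (\<forall>x \<in> ?X. x \<le> 1)"
    unfolding max_density_def by (rule Max_le_iff)
  also have "\<dots> \<longleftrightarrow> (\<forall>S \<subseteq> U. S \<noteq> {} \<longrightarrow> f S / real (card S) \<le> 1)" by blast
  also have "\<dots> \<longleftrightarrow> (\<forall>S \<subseteq> U. S \<noteq> {} \<longrightarrow> f S \<le> real (card S))"
  proof -
    have "f S / real (card S) \<le> 1 \<longleftrightarrow> f S \<le> real (card S)" if "S \<subseteq> U" "S \<noteq> {}" for S
      using that assms by (simp add: card_gt_0_iff finite_subset divide_le_eq_1_pos)
    then show ?thesis by blast
  qed
  finally show ?thesis using False by (simp add: max_density_le_1_def)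
qed

theorem theoremA1:
  fixes V :: "'v set" and E :: "'e set" and ends :: "'e \<Rightarrow> 'v set" and \<I> :: "'e set set"
  assumes "ugraph V E ends"
    and "matroid E \<I>"
  shows "\<exists>f :: 'v set \<Rightarrow> real.
           f {} = 0 \<and>
           (\<forall>S \<subseteq> V. 0 \<le> f S) \<and>
           (\<forall>S \<subseteq> V. f S \<in> \<int>) \<and>
           supermodular_on V f \<and>
           (\<forall>F \<subseteq> V. induced_edges E ends (V - F) \<in> \<I> \<longleftrightarrow>
                    max_density_le_1 (V - F) (restrict f (Pow (V - F))))"
proof -
  interpret ugraph V E ends by fact
  interpret matroid E \<I> by fact
  define D where "D S \<longleftrightarrow> induced_edges E ends S \<notin> \<I>" for S
  define f :: "'v set \<Rightarrow> real" where "f S = (if D S then 2 ^ card S else 0)" for S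
  have D_mono: "D B" if "A \<subseteq> B" "D A" for A B
  proof -
    have "induced_edges E ends A \<subseteq> induced_edges E ends B"
      using that(1) by (auto simp: induced_edges_def)
    then show ?thesis using that(2) indep_subset unfolding D_def by blast
  qed
  \<comment> \<open>An edge without ends would be induced by the empty set and could make it
    dependent, giving \<open>f {} = 1\<close>.\<close>
  have "ends e \<noteq> {}" if "e \<in> E" for e
    using card_ends[OF that] by auto
  then have "induced_edges E ends {} = {}"
    by (auto simp: induced_edges_def)
  then have D_empty: "\<not> D {}" by (simp add: D_def indep_empty)
  have "supermodular_on V f"
    unfolding f_def by (rule supermodular_on_upward_closed_pow2[OF finite_V]) (rule D_mono)
  moreover
  have "induced_edges E ends U \<in> \<I> \<longleftrightarrow> max_density_le_1 U (restrict f (Pow U))" if "U \<subseteq> V" for U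
  proof -
    \<comment> \<open>The criterion evaluates the function only on subsets of \<open>U\<close>,
      where the restriction agrees with \<open>f\<close>.\<close>
    have "max_density_le_1 U (restrict f (Pow U)) \<longleftrightarrow>
        (\<forall>S \<subseteq> U. S \<noteq> {} \<longrightarrow> f S \<le> real (card S))"
      using finite_subset[OF that finite_V] by (simp add: max_density_le_1_iff)
    also have "\<dots> \<longleftrightarrow> (\<forall>S \<subseteq> U. S \<noteq> {} \<longrightarrow> \<not> D S)"
    proof -
      \<comment> \<open>This is \<open>k < 2 ^ k\<close>; it covers infinite \<open>S\<close> too,
        where \<open>card S = 0\<close> and the dependent value is 1.\<close>
      have "f S \<le> real (card S) \<longleftrightarrow> \<not> D S" for S
        by (simp add: f_def not_le of_nat_less_two_power del: of_nat_power)
      then show ?thesis by simp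
    qed
    \<comment> \<open>A dependent subset makes \<open>U\<close> dependent; conversely a dependent
      \<open>U\<close> is itself a nonempty witness, since \<open>{}\<close> is independent.\<close>
    also have "\<dots> \<longleftrightarrow> \<not> D U" using D_empty D_mono by blast
    finally show ?thesis by (simp add: D_def)
  qed
  then have "\<forall>F \<subseteq> V. induced_edges E ends (V - F) \<in> \<I> \<longleftrightarrow>
      max_density_le_1 (V - F) (restrict f (Pow (V - F)))"
    by blast
  moreover have "f {} = 0" "\<forall>S \<subseteq> V. 0 \<le> f S" "\<forall>S \<subseteq> V. f S \<in> \<int>"
    by (simp_all add: f_def D_empty)
  ultimately show ?thesis by blast
qed

end
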